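(* Let $\varphi\colon\mathbb{R}^2\to\mathbb{R}$ be the Cartesian box spline and let $\mathrm{ReLU}(t) = \max(t,0)$ for $t\in\mathbb{R}$. Then, for all $\mathbf{x} = (x_1,x_2)\in\mathbb{R}^2$, $$\varphi(\mathbf{x}) = \mathrm{ReLU}\big(1 - \mathrm{ReLU}(x_1-x_2) - \mathrm{ReLU}(x_2) - \mathrm{ReLU}(-x_1)\big).$$
   Context: The Cartesian box spline is the continuous function given by $$\varphi(\mathbf{x}) = \max\big(1+\min(x_1,x_2,0)-\max(x_1,x_2,0),\,0\big).$$ Equivalently, it is the continuous function whose Fourier transform is $\hat\varphi(\boldsymbol{\omega}) = \mathrm{sinc}\big(\tfrac{\omega_1+\omega_2}{2}\big)\mathrm{sinc}\big(\tfrac{\omega_1}{2}\big)\mathrm{sinc}\big(\tfrac{\omega_2}{2}\big)$, where $\mathrm{sinc}(\omega)=\sin(\omega)/\omega$, $\mathrm{sinc}(0)=1$, and $\hat\varphi(\boldsymbol{\omega}) = \int_{\mathbb{R}^2}\varphi(\mathbf{x})e^{-\mathrm{j}\boldsymbol{\omega}^\top\mathbf{x}}\,\mathrm{d}\mathbf{x}$. *)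

theory Defs
  imports "HOL-Analysis.Analysis"
begin

definition cartesian_box_spline :: "real ^ 2 \<Rightarrow> real" where
  "cartesian_box_spline x =
     max (1 + Min {x $ 1, x $ 2, 0} - Max {x $ 1, x $ 2, 0}) 0"

definition ReLU :: "real \<Rightarrow> real" where
  "ReLU t = max t 0"

end

theory Submission imports Defs begin

text \<open>
  The spline depends on \<open>x\<close> only through the spread (largest minus smallest) of the three numbers
  \<open>x $ 1\<close>, \<open>x $ 2\<close>, \<open>0\<close>. A closed walk through three reals changes direction at most twice, so it
  descends monotonically from the maximum to the minimum and climbs monotonically back; its total
  descent is therefore exactly the spread. Along the cycle \<open>x $ 1 \<rightarrow> x $ 2 \<rightarrow> 0 \<rightarrow> x $ 1\<close> the
  descents are \<open>ReLU (x $ 1 - x $ 2)\<close>, \<open>ReLU (x $ 2)\<close> and \<open>ReLU (- (x $ 1))\<close>, and the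
  outer \<open>ReLU\<close> is the truncation at zero in the spline.
\<close>

text \<open>
  With four or more points the total descent of a cycle can exceed the spread; three points leave no
  room for a second local maximum.
\<close>
lemma spread_eq_total_descent_of_3_cycle:
  "Max {a, b, c} - Min {a, b, c} = ReLU (a - b) + ReLU (b - c) + ReLU (c - a)"
  by (simp add: ReLU_def max_def min_def)

theorem theorem3:
  fixes x :: "real ^ 2"
  shows "cartesian_box_spline x =
    ReLU (1 - ReLU (x $ 1 - x $ 2) - ReLU (x $ 2) - ReLU (- (x $ 1)))"
proof -
  have "1 + Min {x $ 1, x $ 2, 0} - Max {x $ 1, x $ 2, 0} =
      1 - ReLU (x $ 1 - x $ 2) - ReLU (x $ 2) - ReLU (- (x $ 1))"
    using spread_eq_total_descent_of_3_cycle[of "x $ 1" "x $ 2" 0]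
    unfolding diff_0_right diff_0 by linarith
  then show ?thesis
    unfolding cartesian_box_spline_def by (simp only: ReLU_def[symmetric])
qed

end
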